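(* Let $q\ge 1$ and let $p(y|x_1,x_2)$, $x_1,x_2\in\{0,1\}$, $y\in\mathcal Y=\{s_0,\dots,s_{q-1}\}$, be the transition probabilities of a 2-user discrete memoryless multiple access channel. Then the sum rates satisfy $r_s^{TIN}\le r_s^{SC}$, with equality if and only if $$p_{3,s_j}\,p_{0,s_j}=p_{2,s_j}\,p_{1,s_j}\quad\text{for all } j=0,1,\dots,q-1 .$$ Moreover, if $r_s^{TIN}=r_s^{SC}$, then $\mathscr R^{TIN}=\mathscr R^{SC}$ and this rate region is an axis-parallel (possibly degenerate) rectangle.
   Context: Write $p_{2x_1+x_2,\,y}:=P(Y=y\mid X_1=x_1,X_2=x_2)$, so e.g. $p_{2,s_0}=P(Y=s_0|X_1=1,X_2=0)$. The inputs $X_1,X_2$ are independent and uniform on $\{0,1\}$, and $Y$ is the channel output; so $P(X_1=x_1,X_2=x_2,Y=y)=\frac14 p_{2x_1+x_2,y}$. All (conditional) mutual informations are computed with respect to this joint law, with logarithms to base 2. TIN (treating interference as noise): $\mathscr R^{TIN}=\{(R_1,R_2): 0\le R_1\le I(X_1;Y),\ 0\le R_2\le I(X_2;Y)\}$, and $r_s^{TIN}=\max\{R_1+R_2:(R_1,R_2)\in\mathscr R^{TIN}\}=I(X_1;Y)+I(X_2;Y)$. SC (successive cancelation): $\mathscr R^{SC}=\{(R_1,R_2): R_1,R_2\ge 0,\ R_1\le I(X_1;Y|X_2),\ R_2\le I(X_2;Y|X_1),\ R_1+R_2\le I(X_1,X_2;Y)\}$, and $r_s^{SC}=\max\{R_1+R_2:(R_1,R_2)\in\mathscr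 R^{SC}\}=I(X_1,X_2;Y)$. *)

theory Defs
  imports "HOL-Probability.Probability"
begin

text \<open>
  \<open>W x1 x2 y\<close> is the probability \<open>p(y | x1, x2)\<close> that the channel outputs \<open>y\<close> on the input
  pair \<open>(x1, x2)\<close>; only the values on \<open>{0,1} \<times> {0,1} \<times> A\<close> are relevant.  Memorylessness means that
  the channel is determined by its single-use law \<open>W\<close>.
\<close>

definition binary_mac :: "'y set \<Rightarrow> (nat \<Rightarrow> nat \<Rightarrow> 'y \<Rightarrow> real) \<Rightarrow> bool" where
  "binary_mac A W \<longleftrightarrow> finite A \<and> A \<noteq> {} \<and>
     (\<forall>x1\<in>{0,1}. \<forall>x2\<in>{0,1}. (\<forall>y\<in>A. 0 \<le> W x1 x2 y) \<and> (\<Sum>y\<in>A. W x1 x2 y) = 1)"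

definition mac_law :: "'y set \<Rightarrow> (nat \<Rightarrow> nat \<Rightarrow> 'y \<Rightarrow> real) \<Rightarrow> (nat \<times> nat \<times> 'y) measure" where
  "mac_law A W = point_measure ({0,1} \<times> {0,1} \<times> A) (\<lambda>(x1, x2, y). ennreal (1/4 * W x1 x2 y))"

definition X1 :: "nat \<times> nat \<times> 'y \<Rightarrow> nat" where "X1 = (\<lambda>(x1, x2, y). x1)"
definition X2 :: "nat \<times> nat \<times> 'y \<Rightarrow> nat" where "X2 = (\<lambda>(x1, x2, y). x2)"
definition Y :: "nat \<times> nat \<times> 'y \<Rightarrow> 'y" where "Y = (\<lambda>(x1, x2, y). y)"

text \<open>
  The index \<open>k = 2 * x1 + x2\<close> is decoded by \<open>x1 = k div 2\<close> and \<open>x2 = k mod 2\<close>;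
  see \<open>trans_prob_eq\<close> below.
\<close>

definition trans_prob :: "'y set \<Rightarrow> (nat \<Rightarrow> nat \<Rightarrow> 'y \<Rightarrow> real) \<Rightarrow> nat \<Rightarrow> 'y \<Rightarrow> real" where
  "trans_prob A W k y =
     \<P>(\<omega> in mac_law A W. Y \<omega> = y \<bar> X1 \<omega> = k div 2 \<and> X2 \<omega> = k mod 2)"

text \<open>
  Mutual informations in bits of random variables on a probability space with finite range,
  for the discrete \<open>\<sigma>\<close>-algebras on their ranges: these are \<open>\<I>(U ; V)\<close> and
  \<open>\<I>(U ; V | Z)\<close> of the locale \<open>information_space\<close> at base 2.
\<close>

definition MI :: "'a measure \<Rightarrow> ('a \<Rightarrow> 'b) \<Rightarrow> ('a \<Rightarrow> 'c) \<Rightarrow> real" where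
  "MI M U V = prob_space.mutual_information M 2
     (count_space (U ` space M)) (count_space (V ` space M)) U V"

definition CMI :: "'a measure \<Rightarrow> ('a \<Rightarrow> 'b) \<Rightarrow> ('a \<Rightarrow> 'c) \<Rightarrow> ('a \<Rightarrow> 'd) \<Rightarrow> real" where
  "CMI M U V Z = prob_space.conditional_mutual_information M 2
     (count_space (U ` space M)) (count_space (V ` space M)) (count_space (Z ` space M)) U V Z"

definition region_TIN :: "'y set \<Rightarrow> (nat \<Rightarrow> nat \<Rightarrow> 'y \<Rightarrow> real) \<Rightarrow> (real \<times> real) set" where
  "region_TIN A W = {(R1, R2).
     0 \<le> R1 \<and> R1 \<le> MI (mac_law A W) X1 Y \<and> 0 \<le> R2 \<and> R2 \<le> MI (mac_law A W) X2 Y}"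

definition region_SC :: "'y set \<Rightarrow> (nat \<Rightarrow> nat \<Rightarrow> 'y \<Rightarrow> real) \<Rightarrow> (real \<times> real) set" where
  "region_SC A W = {(R1, R2). 0 \<le> R1 \<and> 0 \<le> R2 \<and>
     R1 \<le> CMI (mac_law A W) X1 Y X2 \<and> R2 \<le> CMI (mac_law A W) X2 Y X1 \<and>
     R1 + R2 \<le> MI (mac_law A W) (\<lambda>\<omega>. (X1 \<omega>, X2 \<omega>)) Y}"

text \<open>\<open>GREATEST\<close> is an attained maximum; \<open>Max\<close> only applies to finite sets.\<close>

definition sum_rate :: "(real \<times> real) set \<Rightarrow> real" where
  "sum_rate R = (GREATEST r. \<exists>(R1, R2)\<in>R. r = R1 + R2)"

definition axis_parallel_rectangle :: "(real \<times> real) set \<Rightarrow> bool" where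
  "axis_parallel_rectangle R \<longleftrightarrow> (\<exists>a b c d. a \<le> b \<and> c \<le> d \<and> R = {a..b} \<times> {c..d})"


lemma prob_space_mac_law:
  assumes "binary_mac A W"
  shows "prob_space (mac_law A W)"
proof
  have fin: "finite A" and nn: "\<And>x1 x2 y. x1 \<in> {0,1} \<Longrightarrow> x2 \<in> {0,1} \<Longrightarrow> y \<in> A \<Longrightarrow> 0 \<le> W x1 x2 y"
    and one: "\<And>x1 x2. x1 \<in> {0,1} \<Longrightarrow> x2 \<in> {0,1} \<Longrightarrow> (\<Sum>y\<in>A. W x1 x2 y) = 1"
    using assms unfolding binary_mac_def by auto
  let ?S = "{0,1} \<times> {0,1} \<times> A"
  have "emeasure (mac_law A W) (space (mac_law A W)) =
      (\<Sum>(x1, x2, y)\<in>?S. ennreal (1/4 * W x1 x2 y))"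
    unfolding mac_law_def space_point_measure
    by (rule emeasure_point_measure_finite) (use fin in auto)
  also have "\<dots> = ennreal (\<Sum>(x1, x2, y)\<in>?S. 1/4 * W x1 x2 y)"
    unfolding split_def by (rule sum_ennreal) (use nn in auto)
  also have "(\<Sum>(x1, x2, y)\<in>?S. 1/4 * W x1 x2 y) =
      (\<Sum>x1\<in>{0,1}. \<Sum>x2\<in>{0,1}. \<Sum>y\<in>A. 1/4 * W x1 x2 y)"
    by (simp only: sum.cartesian_product)
  also have "\<dots> = 1"
    by (simp add: sum_divide_distrib[symmetric] one)
  finally show "emeasure (mac_law A W) (space (mac_law A W)) = 1" by simp
qed

lemma measure_mac_law:
  assumes "binary_mac A W" "E \<subseteq> {0,1} \<times> {0,1} \<times> A"
  shows "measure (mac_law A W) E = (\<Sum>(x1, x2, y)\<in>E. 1/4 * W x1 x2 y)"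
proof -
  have fin: "finite A" and nn: "\<And>x1 x2 y. x1 \<in> {0,1} \<Longrightarrow> x2 \<in> {0,1} \<Longrightarrow> y \<in> A \<Longrightarrow> 0 \<le> W x1 x2 y"
    using assms(1) unfolding binary_mac_def by auto
  have *: "finite ({0,1::nat} \<times> {0,1::nat} \<times> A)" using fin by auto
  have "emeasure (mac_law A W) E = (\<Sum>(x1, x2, y)\<in>E. ennreal (1/4 * W x1 x2 y))"
    unfolding mac_law_def by (rule emeasure_point_measure_finite[OF * assms(2)])
  also have "\<dots> = ennreal (\<Sum>(x1, x2, y)\<in>E. 1/4 * W x1 x2 y)"
    unfolding split_def by (rule sum_ennreal) (use nn assms(2) in auto)
  finally show ?thesis
    by (rule measure_eq_emeasure_eq_ennreal[rotated]) (intro sum_nonneg, use nn assms(2) in auto)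
qed

lemma trans_prob_eq:
  assumes W: "binary_mac A W" and x: "x1 \<in> {0,1}" "x2 \<in> {0,1}" and y: "y \<in> A"
  shows "trans_prob A W (2 * x1 + x2) y = W x1 x2 y"
proof -
  have one: "(\<Sum>y\<in>A. W x1 x2 y) = 1"
    using assms unfolding binary_mac_def by blast
  have dm: "(2 * x1 + x2) div 2 = x1" "(2 * x1 + x2) mod 2 = x2"
    using x by auto
  have s: "space (mac_law A W) = {0,1} \<times> {0,1} \<times> A"
    by (simp add: mac_law_def space_point_measure)
  have "{\<omega> \<in> space (mac_law A W). Y \<omega> = y \<and> X1 \<omega> = x1 \<and> X2 \<omega> = x2} = {(x1, x2, y)}"
    using x y by (auto simp: s X1_def X2_def Y_def)
  moreover have "measure (mac_law A W) {(x1, x2, y)} = 1/4 * W x1 x2 y"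
    using x y by (subst measure_mac_law[OF W]) auto
  moreover have "{\<omega> \<in> space (mac_law A W). X1 \<omega> = x1 \<and> X2 \<omega> = x2} = Pair x1 ` Pair x2 ` A"
    using x by (auto simp: s X1_def X2_def)
  moreover have "measure (mac_law A W) (Pair x1 ` Pair x2 ` A) = 1/4"
  proof -
    have "measure (mac_law A W) (Pair x1 ` Pair x2 ` A) =
        (\<Sum>(x1, x2, y)\<in>Pair x1 ` Pair x2 ` A. 1/4 * W x1 x2 y)"
      by (rule measure_mac_law[OF W]) (use x in auto)
    also have "\<dots> = (\<Sum>y\<in>A. 1/4 * W x1 x2 y)"
      by (simp add: sum.reindex inj_on_def)
    also have "\<dots> = 1/4"
      by (simp only: sum_distrib_left[symmetric] one mult_1_right)
    finally show ?thesis .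
  qed
  ultimately show ?thesis
    unfolding trans_prob_def cond_prob_def dm by (simp only:) simp
qed

end

theory Submission
  imports Defs
begin

text \<open>
  Independence of the inputs and the chain rule give
  \<open>I(X1,X2;Y) - I(X1;Y) - I(X2;Y) = I(X1;X2|Y)\<close>.  This conditional mutual information is an average
  of Kullback--Leibler divergences between the \<open>2 \<times> 2\<close> matrix \<open>P(x1,x2,y)\<close> and the product of its
  margins, so it is nonnegative, and it vanishes iff for every \<open>y\<close> the matrix has rank at most one,
  i.e. zero determinant.  The same quantity is the gap \<open>I(X1;Y|X2) - I(X1;Y)\<close> and
  \<open>I(X2;Y|X1) - I(X2;Y)\<close>, so if it is zero the sum constraint of the SC region is
  implied by the two individual ones, which coincide with those of the TIN region.
\<close>

section \<open>The divergence of a nonnegative two-by-two matrix from its margins\<close>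

text \<open>For the matrix with rows \<open>a, b\<close> and \<open>c, d\<close> and total
  \<open>t\<close>, each term is \<open>p * log 2 (p / u)\<close>, where \<open>u\<close> is the
  product of the row and column sums divided by \<open>t\<close>. Since \<open>t\<close> is not
  normalized to 1, the joint masses at a fixed output already carry the weight of that
  output.\<close>

definition margin_divergence :: "real \<Rightarrow> real \<Rightarrow> real \<Rightarrow> real \<Rightarrow> real" where
  "margin_divergence a b c d =
     a * log 2 (a * (a + b + c + d) / ((a + b) * (a + c))) +
     b * log 2 (b * (a + b + c + d) / ((a + b) * (b + d))) +
     c * log 2 (c * (a + b + c + d) / ((c + d) * (a + c))) +
     d * log 2 (d * (a + b + c + d) / ((c + d) * (b + d)))"

text \<open>The tangent bound \<open>ln x \<le> x - 1\<close> at \<open>x = u / p\<close> is tight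
  only at \<open>x = 1\<close>. For \<open>p = 0\<close> the claim reduces to
  \<open>- u \<le> 0\<close>, tight only at \<open>u = 0\<close>.\<close>

lemma mult_log_div_ge:
  fixes p u :: real
  assumes "0 \<le> p" "0 \<le> u" "p > 0 \<Longrightarrow> u > 0"
  shows "(p - u) / ln 2 \<le> p * log 2 (p / u)"
    and "p * log 2 (p / u) = (p - u) / ln 2 \<Longrightarrow> p = u"
proof -
  have *: "p - u \<le> p * ln (p / u) \<and> (p * ln (p / u) = p - u \<longrightarrow> p = u)"
  proof (cases "p = 0")
    case False
    with assms have pos: "p > 0" "u > 0" by auto
    have inv: "ln (u / p) = - ln (p / u)"
      using pos by (simp add: ln_div)
    have "ln (u / p) \<le> u / p - 1"
      using pos by (intro ln_le_minus_one) auto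
    then have "p * (1 - u / p) \<le> p * ln (p / u)"
      using pos inv by (intro mult_left_mono) auto
    moreover have "p * (1 - u / p) = p - u"
      using pos by (simp add: field_simps)
    moreover have "p = u" if "p * ln (p / u) = p - u"
    proof -
      have "ln (u / p) = u / p - 1"
        using that pos inv by (simp add: field_simps)
      then have "u / p = 1"
        using pos by (intro ln_eq_minus_one) auto
      then show ?thesis using pos by simp
    qed
    ultimately show ?thesis by auto
  qed (use assms in auto)
  have "p * log 2 (p / u) = (p * ln (p / u)) / ln 2"
    by (simp add: log_def)
  with * show "(p - u) / ln 2 \<le> p * log 2 (p / u)"
    and "p * log 2 (p / u) = (p - u) / ln 2 \<Longrightarrow> p = u"
    by (simp_all add: divide_right_mono)
qed

text \<open>The tangent bounds of the four entries add up to zero, because the entries and the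
  products of margins over \<open>t\<close> have the same total. Equality forces every bound to be
  tight, and \<open>a * t = (a + b) * (a + c)\<close> expands to the determinant condition.\<close>

lemma
  fixes a b c d :: real
  assumes nn: "0 \<le> a" "0 \<le> b" "0 \<le> c" "0 \<le> d"
  shows margin_divergence_nonneg: "0 \<le> margin_divergence a b c d"
    and margin_divergence_eq_0_iff: "margin_divergence a b c d = 0 \<longleftrightarrow> d * a = c * b"
proof -
  define t where "t = a + b + c + d"
  have gibbs: "(p - r * s / t) / ln 2 \<le> p * log 2 (p * t / (r * s))"
      "p * log 2 (p * t / (r * s)) = (p - r * s / t) / ln 2 \<Longrightarrow> p = r * s / t"
    if "0 \<le> p" "p \<le> r" "p \<le> s" "r \<le> t" for p r s
  proof -
    have "p > 0 \<Longrightarrow> r * s / t > 0" "0 \<le> r * s / t"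
      using that by (auto intro!: mult_pos_pos divide_pos_pos divide_nonneg_nonneg mult_nonneg_nonneg)
    then show "(p - r * s / t) / ln 2 \<le> p * log 2 (p * t / (r * s))"
      "p * log 2 (p * t / (r * s)) = (p - r * s / t) / ln 2 \<Longrightarrow> p = r * s / t"
      using mult_log_div_ge[of p "r * s / t"] that by auto
  qed
  have G: "margin_divergence a b c d =
     a * log 2 (a * t / ((a + b) * (a + c))) + b * log 2 (b * t / ((a + b) * (b + d))) +
     c * log 2 (c * t / ((c + d) * (a + c))) + d * log 2 (d * t / ((c + d) * (b + d)))"
    by (simp add: margin_divergence_def t_def)
  note ga = gibbs[of a "a + b" "a + c"] and gb = gibbs[of b "a + b" "b + d"]
    and gc = gibbs[of c "c + d" "a + c"] and gd = gibbs[of d "c + d" "b + d"]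
  \<comment> \<open>The numerators add up to \<open>t * t\<close>; for \<open>t = 0\<close> both
    sides vanish since \<open>x / 0 = 0\<close>.\<close>
  have sum: "(a + b) * (a + c) / t + (a + b) * (b + d) / t + (c + d) * (a + c) / t
      + (c + d) * (b + d) / t = t"
  proof (cases "t = 0")
    case False
    have "(a + b) * (a + c) + (a + b) * (b + d) + (c + d) * (a + c) + (c + d) * (b + d) = t * t"
      by (simp add: t_def algebra_simps)
    with False show ?thesis by (simp add: add_divide_distrib[symmetric])
  qed simp
  have sum': "(a - (a + b) * (a + c) / t) / ln 2 + (b - (a + b) * (b + d) / t) / ln 2
      + (c - (c + d) * (a + c) / t) / ln 2 + (d - (c + d) * (b + d) / t) / ln 2 = 0"
    unfolding add_divide_distrib[symmetric] using sum t_def by simp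
  have bounds: "a + b \<le> t" "c + d \<le> t"
    using nn by (auto simp: t_def)
  show "0 \<le> margin_divergence a b c d"
    unfolding G using ga(1) gb(1) gc(1) gd(1) sum' nn bounds by simp
  show "margin_divergence a b c d = 0 \<longleftrightarrow> d * a = c * b"
  proof
    assume "margin_divergence a b c d = 0"
    \<comment> \<open>Four terms lie above bounds of total zero, so each equals its bound; the entry
      \<open>a\<close> alone suffices.\<close>
    then have "a * log 2 (a * t / ((a + b) * (a + c))) = (a - (a + b) * (a + c) / t) / ln 2"
      unfolding G using ga(1) gb(1) gc(1) gd(1) sum' nn bounds by simp
    then have "a = (a + b) * (a + c) / t"
      using ga(2) nn bounds by simp
    moreover have "t = 0 \<Longrightarrow> a = 0 \<and> b = 0"
      using nn by (auto simp: t_def)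
    ultimately have "a * t = (a + b) * (a + c)"
      by (cases "t = 0") (auto simp: field_simps)
    then show "d * a = c * b"
      by (simp add: t_def algebra_simps)
  next
    assume det: "d * a = c * b"
    \<comment> \<open>Zero determinant gives \<open>p * t = r * s\<close> for every entry, so the
      logarithm is that of 1. If \<open>r * s = 0\<close>, either the factor \<open>p\<close> is 0,
      or \<open>t = 0\<close> and the convention \<open>ln 0 = 0\<close> applies.\<close>
    have vanish: "p * log 2 (p * t / (r * s)) = 0" if "p * t = r * s" for p r s
    proof (cases "r * s = 0")
      case True
      with that have "p = 0 \<or> t = 0" by simp
      then show ?thesis by (auto simp: log_def)
    qed (use that in simp)
    show "margin_divergence a b c d = 0"
      unfolding G using det
      by (subst (1 2 3 4) vanish) (simp_all add: t_def algebra_simps)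
  qed
qed

text \<open>Pointwise chain rules: \<open>p\<close> is a joint mass, \<open>r\<close> and
  \<open>s\<close> are the masses of either input with the output, \<open>t\<close> is the output
  mass, and \<open>1/2\<close>, \<open>1/4\<close> come from the uniform inputs. The last term is a
  summand of \<open>margin_divergence\<close>. The bounds make all quantities positive when
  \<open>p > 0\<close>.\<close>

lemma log_split:
  fixes p r s t :: real
  assumes "0 \<le> p" "p \<le> r" "p \<le> s" "r \<le> t"
  shows "p * log 2 (p / (1/4 * t)) =
      p * log 2 (r / (1/2 * t)) + p * log 2 (s / (1/2 * t)) + p * log 2 (p * t / (r * s))"
    and "p * log 2 (p / (1/4 * (s / (1/2)))) =
      p * log 2 (r / (1/2 * t)) + p * log 2 (p * t / (r * s))"
proof -
  have "log 2 (p / (1/4 * t)) =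
      log 2 (r / (1/2 * t)) + log 2 (s / (1/2 * t)) + log 2 (p * t / (r * s)) \<and>
    log 2 (p / (1/4 * (s / (1/2)))) = log 2 (r / (1/2 * t)) + log 2 (p * t / (r * s))" if "p > 0"
  proof -
    have "r > 0" "s > 0" "t > 0" using that assms by auto
    moreover have "log 2 4 = (2::real)"
      using log_pow_cancel[of "2::real" 2] by simp
    ultimately show ?thesis
      using that by (simp add: log_mult log_divide)
  qed
  then show "p * log 2 (p / (1/4 * t)) =
      p * log 2 (r / (1/2 * t)) + p * log 2 (s / (1/2 * t)) + p * log 2 (p * t / (r * s))"
    and "p * log 2 (p / (1/4 * (s / (1/2)))) =
      p * log 2 (r / (1/2 * t)) + p * log 2 (p * t / (r * s))"
    using assms by (cases "p = 0"; simp add: distrib_left[symmetric])+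
qed

section \<open>The mutual informations of the channel\<close>

text \<open>
  Unlike \<open>simple_distributed\<close>, which asks for \<open>0 \<le> P x\<close> everywhere, this constrains \<open>P\<close> only on the
  range of \<open>X\<close>: the values \<open>W x1 x2 y\<close> outside of \<open>{0,1} \<times> {0,1} \<times> A\<close> are arbitrary.
\<close>

definition mass_function :: "'a measure \<Rightarrow> ('a \<Rightarrow> 'b) \<Rightarrow> ('b \<Rightarrow> real) \<Rightarrow> bool" where
  "mass_function M X P \<longleftrightarrow> simple_function M X \<and>
     (\<forall>\<omega>\<in>space M. measure M (X -` {X \<omega>} \<inter> space M) = P (X \<omega>))"

text \<open>The true fibre probabilities are nonnegative everywhere, so they meet
  \<open>simple_distributed\<close> even where \<open>P\<close> is arbitrary.\<close>

lemma (in prob_space) simple_distributed_mass_function: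
  assumes "mass_function M X P"
  shows "simple_distributed M X (\<lambda>x. prob (X -` {x} \<inter> space M))"
  using assms by (intro simple_distributedI) (auto simp: mass_function_def)

text \<open>The information formula sums over the range of the pair, where the fibre probabilities
  agree with \<open>Px\<close>, \<open>Py\<close> and \<open>Pxy\<close>.\<close>

lemma (in information_space) mutual_information_mass_function:
  fixes X :: "'a \<Rightarrow> 'b" and Y :: "'a \<Rightarrow> 'c"
  assumes X: "mass_function M X Px" and Y: "mass_function M Y Py"
    and XY: "mass_function M (\<lambda>\<omega>. (X \<omega>, Y \<omega>)) Pxy"
  shows "\<I>(X ; Y) = (\<Sum>(x, y)\<in>(\<lambda>\<omega>. (X \<omega>, Y \<omega>)) ` space M.
    Pxy (x, y) * log b (Pxy (x, y) / (Px x * Py y)))"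
  using X Y XY
  unfolding mutual_information_simple_distributed[OF assms[THEN simple_distributed_mass_function]]
  by (intro sum.cong) (auto simp: mass_function_def)

lemma (in information_space) conditional_mutual_information_mass_function:
  fixes X :: "'a \<Rightarrow> 'b" and Y :: "'a \<Rightarrow> 'c" and Z :: "'a \<Rightarrow> 'd"
  assumes Z: "mass_function M Z Pz"
    and YZ: "mass_function M (\<lambda>\<omega>. (Y \<omega>, Z \<omega>)) Pyz"
    and XZ: "mass_function M (\<lambda>\<omega>. (X \<omega>, Z \<omega>)) Pxz"
    and XYZ: "mass_function M (\<lambda>\<omega>. (X \<omega>, Y \<omega>, Z \<omega>)) Pxyz"
  shows "\<I>(X ; Y | Z) = (\<Sum>(x, y, z)\<in>(\<lambda>\<omega>. (X \<omega>, Y \<omega>, Z \<omega>)) ` space M.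
    Pxyz (x, y, z) * log b (Pxyz (x, y, z) / (Pxz (x, z) * (Pyz (y, z) / Pz z))))"
  using Z YZ XZ XYZ
  unfolding conditional_mutual_information_eq[OF assms[THEN simple_distributed_mass_function]]
  by (intro sum.cong) (auto simp: mass_function_def)

lemma space_mac_law: "space (mac_law A W) = {0,1} \<times> {0,1} \<times> A"
  by (simp add: mac_law_def space_point_measure)

lemma simple_function_mac_law:
  assumes "binary_mac A W"
  shows "simple_function (mac_law A W) f"
proof -
  have "finite (space (mac_law A W))"
    using assms by (auto simp: binary_mac_def space_mac_law)
  moreover have "sets (mac_law A W) = Pow (space (mac_law A W))"
    unfolding mac_law_def space_point_measure by (rule sets_point_measure)
  ultimately show ?thesis
    unfolding simple_function_def by auto
qed

text \<open>The fibre mass is a sum over the whole box with an indicator, so that for a coordinate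
  projection \<open>f\<close> simplification decides the equation in \<open>i\<close> and
  \<open>j\<close> and collapses the sum over \<open>z\<close>.\<close>

lemma mass_function_mac_law:
  assumes W: "binary_mac A W"
    and g: "\<And>x1 x2 y. x1 \<in> {0,1} \<Longrightarrow> x2 \<in> {0,1} \<Longrightarrow> y \<in> A \<Longrightarrow>
      (\<Sum>i\<in>{0,1}. \<Sum>j\<in>{0,1}. \<Sum>z\<in>A. if f (i, j, z) = f (x1, x2, y) then 1/4 * W i j z else 0)
        = g (f (x1, x2, y))"
  shows "mass_function (mac_law A W) f g"
  unfolding mass_function_def
proof (intro conjI ballI simple_function_mac_law[OF W])
  fix \<omega> assume \<omega>: "\<omega> \<in> space (mac_law A W)"
  let ?S = "{0,1::nat} \<times> {0,1::nat} \<times> A"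
  have fin: "finite ?S"
    using W by (auto simp: binary_mac_def)
  have preimage: "f -` {f \<omega>} \<inter> ?S = {\<omega>' \<in> ?S. f \<omega>' = f \<omega>}"
    by auto
  have "measure (mac_law A W) (f -` {f \<omega>} \<inter> ?S) = (\<Sum>(i, j, z)\<in>f -` {f \<omega>} \<inter> ?S. 1/4 * W i j z)"
    by (rule measure_mac_law[OF W]) auto
  also have "\<dots> = (\<Sum>(i, j, z)\<in>?S. if f (i, j, z) = f \<omega> then 1/4 * W i j z else 0)"
    unfolding preimage by (subst sum.inter_filter[OF fin]) (auto intro!: sum.cong)
  also have "\<dots> = (\<Sum>i\<in>{0,1}. \<Sum>j\<in>{0,1}. \<Sum>z\<in>A. if f (i, j, z) = f \<omega> then 1/4 * W i j z else 0)"
    by (simp only: sum.cartesian_product)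
  also have "\<dots> = g (f \<omega>)"
    using \<omega> g unfolding space_mac_law by auto
  finally show "measure (mac_law A W) (f -` {f \<omega>} \<inter> space (mac_law A W)) = g (f \<omega>)"
    unfolding space_mac_law .
qed

lemma
  assumes W: "binary_mac A W"
  defines "p \<equiv> \<lambda>i j y. 1/4 * W i j y"
  defines "r \<equiv> \<lambda>i y. p i 0 y + p i 1 y" and "c \<equiv> \<lambda>j y. p 0 j y + p 1 j y"
    and "t \<equiv> \<lambda>y. p 0 0 y + p 0 1 y + p 1 0 y + p 1 1 y"
  shows MI_X1: "MI (mac_law A W) X1 Y =
      (\<Sum>i\<in>{0,1}. \<Sum>y\<in>A. r i y * log 2 (r i y / (1/2 * t y)))" (is ?M1)
    and MI_X2: "MI (mac_law A W) X2 Y =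
      (\<Sum>j\<in>{0,1}. \<Sum>y\<in>A. c j y * log 2 (c j y / (1/2 * t y)))" (is ?M2)
    and MI_X12: "MI (mac_law A W) (\<lambda>\<omega>. (X1 \<omega>, X2 \<omega>)) Y =
      (\<Sum>i\<in>{0,1}. \<Sum>j\<in>{0,1}. \<Sum>y\<in>A. p i j y * log 2 (p i j y / (1/4 * t y)))" (is ?M12)
    and CMI_X1: "CMI (mac_law A W) X1 Y X2 =
      (\<Sum>i\<in>{0,1}. \<Sum>j\<in>{0,1}. \<Sum>y\<in>A. p i j y * log 2 (p i j y / (1/4 * (c j y / (1/2)))))" (is ?C1)
    and CMI_X2: "CMI (mac_law A W) X2 Y X1 =
      (\<Sum>i\<in>{0,1}. \<Sum>j\<in>{0,1}. \<Sum>y\<in>A. p i j y * log 2 (p i j y / (1/4 * (r i y / (1/2)))))" (is ?C2)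
proof -
  let ?M = "mac_law A W"
  interpret information_space ?M 2
    by (intro information_space.intro information_space_axioms.intro prob_space_mac_law[OF W]) simp
  have fin: "finite A" and one: "\<And>i j. i \<in> {0,1} \<Longrightarrow> j \<in> {0,1} \<Longrightarrow> (\<Sum>y\<in>A. W i j y) = 1"
    using W by (auto simp: binary_mac_def)
  note one' = one[of 0 0] one[of 0 "Suc 0"] one[of "Suc 0" 0] one[of "Suc 0" "Suc 0"]
  note defs = X1_def X2_def Y_def p_def r_def c_def t_def fin
  note mf = mass_function_mac_law[OF W]
  have X1: "mass_function ?M X1 (\<lambda>_. 1/2)"
    by (rule mf) (auto simp: defs sum_divide_distrib[symmetric] one')
  have X2: "mass_function ?M X2 (\<lambda>_. 1/2)"
    by (rule mf) (auto simp: defs sum_divide_distrib[symmetric] one')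
  have X12: "mass_function ?M (\<lambda>\<omega>. (X1 \<omega>, X2 \<omega>)) (\<lambda>_. 1/4)"
    by (rule mf) (auto simp: defs sum_divide_distrib[symmetric] one')
  have X21: "mass_function ?M (\<lambda>\<omega>. (X2 \<omega>, X1 \<omega>)) (\<lambda>_. 1/4)"
    by (rule mf) (auto simp: defs sum_divide_distrib[symmetric] one')
  have Y: "mass_function ?M Y t"
    by (rule mf) (auto simp: defs)
  have X1Y: "mass_function ?M (\<lambda>\<omega>. (X1 \<omega>, Y \<omega>)) (\<lambda>(i, y). r i y)"
    by (rule mf) (auto simp: defs)
  have YX1: "mass_function ?M (\<lambda>\<omega>. (Y \<omega>, X1 \<omega>)) (\<lambda>(y, i). r i y)"
    by (rule mf) (auto simp: defs)
  have X2Y: "mass_function ?M (\<lambda>\<omega>. (X2 \<omega>, Y \<omega>)) (\<lambda>(j, y). c j y)"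
    by (rule mf) (auto simp: defs)
  have YX2: "mass_function ?M (\<lambda>\<omega>. (Y \<omega>, X2 \<omega>)) (\<lambda>(y, j). c j y)"
    by (rule mf) (auto simp: defs)
  have X12Y: "mass_function ?M (\<lambda>\<omega>. ((X1 \<omega>, X2 \<omega>), Y \<omega>)) (\<lambda>((i, j), y). p i j y)"
    by (rule mf) (auto simp: defs)
  have X1YX2: "mass_function ?M (\<lambda>\<omega>. (X1 \<omega>, Y \<omega>, X2 \<omega>)) (\<lambda>(i, y, j). p i j y)"
    by (rule mf) (auto simp: defs)
  have X2YX1: "mass_function ?M (\<lambda>\<omega>. (X2 \<omega>, Y \<omega>, X1 \<omega>)) (\<lambda>(j, y, i). p i j y)"
    by (rule mf) (auto simp: defs)
  have "(\<lambda>\<omega>. (X1 \<omega>, Y \<omega>)) ` space ?M = {0,1} \<times> A"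
    unfolding space_mac_law by (auto simp: image_iff X1_def Y_def)
  then show ?M1
    unfolding MI_def mutual_information_mass_function[OF X1 Y X1Y]
    by (simp only: sum.cartesian_product' split_conv)
  have "(\<lambda>\<omega>. (X2 \<omega>, Y \<omega>)) ` space ?M = {0,1} \<times> A"
    unfolding space_mac_law by (auto simp: image_iff X2_def Y_def)
  then show ?M2
    unfolding MI_def mutual_information_mass_function[OF X2 Y X2Y]
    by (simp only: sum.cartesian_product' split_conv)
  have "(\<lambda>\<omega>. ((X1 \<omega>, X2 \<omega>), Y \<omega>)) ` space ?M = ({0,1} \<times> {0,1}) \<times> A"
    unfolding space_mac_law by (auto simp: image_iff X1_def X2_def Y_def)
  then show ?M12
    unfolding MI_def mutual_information_mass_function[OF X12 Y X12Y]
    by (simp only: sum.cartesian_product' split_conv)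
  have "(\<lambda>\<omega>. (X1 \<omega>, Y \<omega>, X2 \<omega>)) ` space ?M = {0,1} \<times> A \<times> {0,1}"
    unfolding space_mac_law by (auto simp: image_iff X1_def X2_def Y_def)
  \<comment> \<open>The triples are ordered as \<open>(x1, y, x2)\<close>; exchanging sums brings
    \<open>y\<close> innermost.\<close>
  then show ?C1
    unfolding CMI_def conditional_mutual_information_mass_function[OF X2 YX2 X12 X1YX2]
    by (simp only: sum.cartesian_product' split_conv sum.swap[of _ "{0,1}" A])
  have "(\<lambda>\<omega>. (X2 \<omega>, Y \<omega>, X1 \<omega>)) ` space ?M = {0,1} \<times> A \<times> {0,1}"
    unfolding space_mac_law by (auto simp: image_iff X1_def X2_def Y_def)
  then have "CMI ?M X2 Y X1 =
      (\<Sum>j\<in>{0,1}. \<Sum>i\<in>{0,1}. \<Sum>y\<in>A. p i j y * log 2 (p i j y / (1/4 * (r i y / (1/2)))))"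
    unfolding CMI_def conditional_mutual_information_mass_function[OF X1 YX1 X21 X2YX1]
    by (simp only: sum.cartesian_product' split_conv sum.swap[of _ "{0,1}" A])
  also have "\<dots> =
      (\<Sum>i\<in>{0,1}. \<Sum>j\<in>{0,1}. \<Sum>y\<in>A. p i j y * log 2 (p i j y / (1/4 * (r i y / (1/2)))))"
    by (rule sum.swap)
  finally show ?C2 .
qed

text \<open>This is \<open>I(X1;X2|Y)\<close>: the matrix at \<open>y\<close> has total
  \<open>P(Y = y)\<close>, the weight of its divergence.\<close>

definition sum_rate_gap :: "'y set \<Rightarrow> (nat \<Rightarrow> nat \<Rightarrow> 'y \<Rightarrow> real) \<Rightarrow> real" where
  "sum_rate_gap A W =
     (\<Sum>y\<in>A. margin_divergence (1/4 * W 0 0 y) (1/4 * W 0 1 y) (1/4 * W 1 0 y) (1/4 * W 1 1 y))"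

lemma
  assumes W: "binary_mac A W"
  shows MI_X12_eq: "MI (mac_law A W) (\<lambda>\<omega>. (X1 \<omega>, X2 \<omega>)) Y =
      MI (mac_law A W) X1 Y + MI (mac_law A W) X2 Y + sum_rate_gap A W"
    and CMI_X1_eq: "CMI (mac_law A W) X1 Y X2 = MI (mac_law A W) X1 Y + sum_rate_gap A W"
    and CMI_X2_eq: "CMI (mac_law A W) X2 Y X1 = MI (mac_law A W) X2 Y + sum_rate_gap A W"
proof -
  define p where "p i j y = 1/4 * W i j y" for i j y
  define r where "r i y = p i 0 y + p i 1 y" for i y
  define c where "c j y = p 0 j y + p 1 j y" for j y
  define t where "t y = p 0 0 y + p 0 1 y + p 1 0 y + p 1 1 y" for y
  have p_nn: "0 \<le> p i j y" if "i \<in> {0,1}" "j \<in> {0,1}" "y \<in> A" for i j y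
    using W that by (auto simp: binary_mac_def p_def)
  have le: "p i j y \<le> r i y" "p i j y \<le> c j y" "r i y \<le> t y" "c j y \<le> t y"
    if "i \<in> {0,1}" "j \<in> {0,1}" "y \<in> A" for i j y
    using that p_nn[of 0 0 y] p_nn[of 0 1 y] p_nn[of 1 0 y] p_nn[of 1 1 y]
    by (auto simp: r_def c_def t_def)
  have gap: "sum_rate_gap A W =
      (\<Sum>i\<in>{0,1}. \<Sum>j\<in>{0,1}. \<Sum>y\<in>A. p i j y * log 2 (p i j y * t y / (r i y * c j y)))"
    by (simp add: sum_rate_gap_def margin_divergence_def sum.distrib p_def r_def c_def t_def)
  \<comment> \<open>The marginal mass in front is expanded back into joint masses, so that all
    informations become sums over the same triples and compare termwise.\<close>
  have M1: "MI (mac_law A W) X1 Y =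
      (\<Sum>i\<in>{0,1}. \<Sum>j\<in>{0,1}. \<Sum>y\<in>A. p i j y * log 2 (r i y / (1/2 * t y)))"
    unfolding MI_X1[OF W] by (simp add: sum.distrib distrib_right p_def r_def t_def)
  have M2: "MI (mac_law A W) X2 Y =
      (\<Sum>i\<in>{0,1}. \<Sum>j\<in>{0,1}. \<Sum>y\<in>A. p i j y * log 2 (c j y / (1/2 * t y)))"
    unfolding MI_X2[OF W] by (simp add: sum.distrib distrib_right p_def c_def t_def)
  show "MI (mac_law A W) (\<lambda>\<omega>. (X1 \<omega>, X2 \<omega>)) Y =
      MI (mac_law A W) X1 Y + MI (mac_law A W) X2 Y + sum_rate_gap A W"
    unfolding MI_X12[OF W] M1 M2 gap sum.distrib[symmetric] p_def[symmetric] t_def[symmetric]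
    by (intro sum.cong refl log_split(1) p_nn le)
  show "CMI (mac_law A W) X1 Y X2 = MI (mac_law A W) X1 Y + sum_rate_gap A W"
    unfolding CMI_X1[OF W] M1 gap sum.distrib[symmetric] p_def[symmetric] c_def[symmetric]
    by (intro sum.cong refl log_split(2) p_nn le)
  \<comment> \<open>The second pointwise rule with row and column sums exchanged.\<close>
  have split: "p i j y * log 2 (p i j y / (1/4 * (r i y / (1/2)))) =
      p i j y * log 2 (c j y / (1/2 * t y)) + p i j y * log 2 (p i j y * t y / (r i y * c j y))"
    if "i \<in> {0,1}" "j \<in> {0,1}" "y \<in> A" for i j y
    using log_split(2)[OF p_nn[OF that] le(2)[OF that] le(1)[OF that] le(4)[OF that]]
    by (simp add: mult.commute[of "c j y"])
  show "CMI (mac_law A W) X2 Y X1 = MI (mac_law A W) X2 Y + sum_rate_gap A W"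
    unfolding CMI_X2[OF W] M2 gap sum.distrib[symmetric] p_def[symmetric] r_def[symmetric]
    by (intro sum.cong refl split)
qed

text \<open>A sum of nonnegative terms vanishes only termwise, and the common factor
  \<open>1/4\<close> cancels from the determinant condition.\<close>

lemma
  assumes W: "binary_mac A W"
  shows sum_rate_gap_nonneg: "0 \<le> sum_rate_gap A W"
    and sum_rate_gap_eq_0_iff:
      "sum_rate_gap A W = 0 \<longleftrightarrow> (\<forall>y\<in>A. W 1 1 y * W 0 0 y = W 1 0 y * W 0 1 y)"
proof -
  have fin: "finite A" and nn: "\<And>i j y. i \<in> {0,1} \<Longrightarrow> j \<in> {0,1} \<Longrightarrow> y \<in> A \<Longrightarrow> 0 \<le> 1/4 * W i j y"
    using W by (auto simp: binary_mac_def)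
  have nn': "0 \<le> margin_divergence (1/4 * W 0 0 y) (1/4 * W 0 1 y) (1/4 * W 1 0 y) (1/4 * W 1 1 y)"
    if "y \<in> A" for y
    using that by (intro margin_divergence_nonneg nn) auto
  then show "0 \<le> sum_rate_gap A W"
    unfolding sum_rate_gap_def by (rule sum_nonneg)
  have eq: "margin_divergence (1/4 * W 0 0 y) (1/4 * W 0 1 y) (1/4 * W 1 0 y) (1/4 * W 1 1 y) = 0
      \<longleftrightarrow> W 1 1 y * W 0 0 y = W 1 0 y * W 0 1 y" if "y \<in> A" for y
    using that by (subst margin_divergence_eq_0_iff) (auto intro!: nn[simplified])
  show "sum_rate_gap A W = 0 \<longleftrightarrow> (\<forall>y\<in>A. W 1 1 y * W 0 0 y = W 1 0 y * W 0 1 y)"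
    unfolding sum_rate_gap_def by (subst sum_nonneg_eq_0_iff[OF fin nn']) (assumption, intro ball_cong refl eq)
qed

lemma
  assumes "binary_mac A W"
  shows MI_X1_nonneg: "0 \<le> MI (mac_law A W) X1 Y"
    and MI_X2_nonneg: "0 \<le> MI (mac_law A W) X2 Y"
proof -
  interpret information_space "mac_law A W" 2
    by (intro information_space.intro information_space_axioms.intro prob_space_mac_law[OF assms]) simp
  show "0 \<le> MI (mac_law A W) X1 Y" "0 \<le> MI (mac_law A W) X2 Y"
    unfolding MI_def by (intro mutual_information_nonneg_simple simple_function_mac_law[OF assms])+
qed

section \<open>The rate regions\<close>

lemma sum_rate_eqI:
  assumes "(R1, R2) \<in> R" "\<And>S1 S2. (S1, S2) \<in> R \<Longrightarrow> S1 + S2 \<le> R1 + R2"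
  shows "sum_rate R = R1 + R2"
  unfolding sum_rate_def using assms by (intro Greatest_equality) auto

lemma sum_rate_TIN:
  assumes "binary_mac A W"
  shows "sum_rate (region_TIN A W) = MI (mac_law A W) X1 Y + MI (mac_law A W) X2 Y"
  using MI_X1_nonneg[OF assms] MI_X2_nonneg[OF assms]
  by (intro sum_rate_eqI) (auto simp: region_TIN_def)

lemma sum_rate_SC:
  assumes W: "binary_mac A W"
  shows "sum_rate (region_SC A W) = MI (mac_law A W) (\<lambda>\<omega>. (X1 \<omega>, X2 \<omega>)) Y"
proof -
  \<comment> \<open>The maximum is attained at the corner where user 2 is decoded first, treating
    user 1 as noise, and user 1 afterwards with \<open>X2\<close> known. A nonnegative gap makes
    this point feasible, and the chain rule puts it on the sum constraint.\<close>
  have "sum_rate (region_SC A W) = CMI (mac_law A W) X1 Y X2 + MI (mac_law A W) X2 Y"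
    using MI_X1_nonneg[OF W] MI_X2_nonneg[OF W] sum_rate_gap_nonneg[OF W]
    by (intro sum_rate_eqI)
      (auto simp: region_SC_def MI_X12_eq[OF W] CMI_X1_eq[OF W] CMI_X2_eq[OF W])
  then show ?thesis
    by (simp add: MI_X12_eq[OF W] CMI_X1_eq[OF W])
qed

theorem theorem1:
  fixes q :: nat and s :: "nat \<Rightarrow> 'y" and A :: "'y set" and W :: "nat \<Rightarrow> nat \<Rightarrow> 'y \<Rightarrow> real"
  assumes "q \<ge> 1" and "inj_on s {..<q}" and "A = s ` {..<q}" and "binary_mac A W"
  shows "sum_rate (region_TIN A W) \<le> sum_rate (region_SC A W)
    \<and> (sum_rate (region_TIN A W) = sum_rate (region_SC A W) \<longleftrightarrow>
         (\<forall>j<q. trans_prob A W 3 (s j) * trans_prob A W 0 (s j)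
              = trans_prob A W 2 (s j) * trans_prob A W 1 (s j)))
    \<and> (sum_rate (region_TIN A W) = sum_rate (region_SC A W) \<longrightarrow>
         region_TIN A W = region_SC A W \<and> axis_parallel_rectangle (region_TIN A W))"
proof -
  note W = assms(4)
  let ?I1 = "MI (mac_law A W) X1 Y" and ?I2 = "MI (mac_law A W) X2 Y"
  have SC: "sum_rate (region_SC A W) = sum_rate (region_TIN A W) + sum_rate_gap A W"
    by (simp add: sum_rate_SC[OF W] sum_rate_TIN[OF W] MI_X12_eq[OF W])
  have tp: "trans_prob A W 0 y = W 0 0 y" "trans_prob A W 1 y = W 0 1 y"
    "trans_prob A W 2 y = W 1 0 y" "trans_prob A W 3 y = W 1 1 y" if "y \<in> A" for y
    using trans_prob_eq[OF W _ _ that, of 0 0] trans_prob_eq[OF W _ _ that, of 0 1]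
      trans_prob_eq[OF W _ _ that, of 1 0] trans_prob_eq[OF W _ _ that, of 1 1]
    by (simp_all add: numeral_eq_Suc)
  have gap: "sum_rate_gap A W = 0 \<longleftrightarrow>
      (\<forall>j<q. trans_prob A W 3 (s j) * trans_prob A W 0 (s j)
           = trans_prob A W 2 (s j) * trans_prob A W 1 (s j))"
    unfolding sum_rate_gap_eq_0_iff[OF W] using tp assms(3) by auto
  have "region_TIN A W = {0..?I1} \<times> {0..?I2}"
    by (auto simp: region_TIN_def)
  \<comment> \<open>Nonnegativity of both informations keeps the two intervals nonempty.\<close>
  then have rect: "axis_parallel_rectangle (region_TIN A W)"
    unfolding axis_parallel_rectangle_def using MI_X1_nonneg[OF W] MI_X2_nonneg[OF W] by blast
  have "region_TIN A W = region_SC A W" if "sum_rate_gap A W = 0"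
    using that
    by (auto simp: region_TIN_def region_SC_def MI_X12_eq[OF W] CMI_X1_eq[OF W] CMI_X2_eq[OF W])
  with SC gap rect sum_rate_gap_nonneg[OF W] show ?thesis by auto
qed

end
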